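(* Let $(\mathcal R,d,F,G)$ be data as described in the context, satisfying properties (P1)--(P7) listed there. The following are equivalent: (i) The set $\mathcal M$ of minimizers of $F$ on $\overline{\mathcal R}$ is nonempty. (ii) $F:\mathcal R\to\mathbb R$ is $G$-invariant, and for some $C,D>0$, $$F(u)\ge C\,d_G(G0,Gu)-D\qquad\text{for all }u\in\mathcal R .$$
   Context: Data. $(\mathcal R,d)$ is a metric space with a distinguished element $0\in\mathcal R$ and metric completion $(\overline{\mathcal R},d)$. $F:\mathcal R\to\mathbb R$ is lower semicontinuous, and $F:\overline{\mathcal R}\to\mathbb R\cup\{+\infty\}$ also denotes its largest lsc extension $F(u)=\sup_{\varepsilon>0}\inf\{F(v):v\in\mathcal R,\ d(u,v)\le\varepsilon\}$. For $u,v\in\mathcal R$, $F(u,v):=F(v)-F(u)$. $\mathcal M=\{u\in\overline{\mathcal R}:F(u)=\inf_{\overline{\mathcal R}}F\}$. $G$ is a group acting on $\mathcal R$, $(g,u)\mapsto g.u$; $\mathcal R/G$ is the orbit space, $Gu$ the orbit of $u$, and $d_G(Gu,Gv):=\inf_{f,g\in G}d(f.u,g.v)$. Properties. (P1) For any $u_0,u_1\in\mathcal R$ there is a $d$-geodesic segment $[0,1]\ni t\mapsto u_t\in\overline{\mathcal R}$ joining $u_0$ to $u_1$ (i.e. $d(u_a,u_b)=|a-b|\,d(u_0,u_1)$) for which $t\mapsto F(u_t)$ is continuous and convex on $[0,1]$. (P2) If $\{u_j\}\subset\overline{\mathcal R}$ satisfies $\lim_jF(u_j)=\inf_{\overline{\mathcal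 R}}F$ and $d(0,u_j)\le C$ for some $C>0$ and all $j$, then there is $u\in\mathcal M$ and a subsequence of $\{u_j\}$ that $d$-converges to $u$. (P3) $\mathcal M\subset\mathcal R$. (P4) $G$ acts on $\mathcal R$ by $d$-isometries (hence the action extends uniquely to an action by $d$-isometries on $\overline{\mathcal R}$). (P5) $G$ acts on $\mathcal M$ transitively. (P6) If $\mathcal M\ne\emptyset$, then for any $u,v\in\mathcal R$ there is $g\in G$ with $d_G(Gu,Gv)=d(u,g.v)$. (P7) For all $u,v\in\mathcal R$ and $g\in G$, $F(u,v)=F(g.u,g.v)$. *)

theory Defs
  imports "HOL-Analysis.Analysis" "HOL-Algebra.Group_Action"
begin

text \<open>
  Throughout, a metric space together with its metric completion is given as a dense subset
  \<open>R\<close> (\<open>closure R = UNIV\<close>) of a type of class \<open>complete_space\<close>; the type itself is the completion.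
  A function \<open>F\<close> on \<open>R\<close> is a function on the whole type whose values outside \<open>R\<close> are never used.
\<close>

definition lsc_on :: "'a::topological_space set \<Rightarrow> ('a \<Rightarrow> real) \<Rightarrow> bool" where
  "lsc_on R F \<longleftrightarrow> (\<forall>x\<in>R. \<forall>c < F x. \<forall>\<^sub>F y in at x within R. c < F y)"

definition lsc_ext :: "'a::metric_space set \<Rightarrow> ('a \<Rightarrow> real) \<Rightarrow> 'a \<Rightarrow> ereal" where
  "lsc_ext R F u = (SUP \<epsilon>\<in>{0<..}. INF v\<in>{v\<in>R. dist u v \<le> \<epsilon>}. ereal (F v))"

definition minimizers :: "'a::metric_space set \<Rightarrow> ('a \<Rightarrow> real) \<Rightarrow> 'a set" where
  "minimizers R F = {u. lsc_ext R F u = (INF v. lsc_ext R F v)}"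

text \<open>
  The library's \<open>convex_on\<close> is for real-valued functions. The arithmetic here is that of \<open>ereal\<close>,
  in particular \<open>0 * \<infinity> = 0\<close>; it is only applied to functions that never take the value \<open>-\<infinity>\<close>.
\<close>
definition ereal_convex_on :: "'v::real_vector set \<Rightarrow> ('v \<Rightarrow> ereal) \<Rightarrow> bool" where
  "ereal_convex_on S f \<longleftrightarrow> convex S \<and>
     (\<forall>x\<in>S. \<forall>y\<in>S. \<forall>t\<in>{0..1}.
        f ((1 - t) *\<^sub>R x + t *\<^sub>R y) \<le> ereal (1 - t) * f x + ereal t * f y)"

definition geodesic_segment :: "'a::metric_space \<Rightarrow> 'a \<Rightarrow> (real \<Rightarrow> 'a) \<Rightarrow> bool" where
  "geodesic_segment u0 u1 u \<longleftrightarrow> u 0 = u0 \<and> u 1 = u1 \<and>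
     (\<forall>a\<in>{0..1}. \<forall>b\<in>{0..1}. dist (u a) (u b) = \<bar>a - b\<bar> * dist u0 u1)"

definition increment :: "('a \<Rightarrow> real) \<Rightarrow> 'a \<Rightarrow> 'a \<Rightarrow> real" where
  "increment F u v = F v - F u"

text \<open>The pseudometric on the orbit space, written in terms of representatives of the orbits.\<close>
definition orbit_dist ::
  "('g, 'm) monoid_scheme \<Rightarrow> ('g \<Rightarrow> 'a \<Rightarrow> 'a) \<Rightarrow> 'a::metric_space \<Rightarrow> 'a \<Rightarrow> real" where
  "orbit_dist G \<phi> u v = (INF (f, g)\<in>carrier G \<times> carrier G. dist (\<phi> f u) (\<phi> g v))"

end

theory Submission
  imports Defs
begin

text \<open>
  If \<open>F\<close> is invariant and coercive, each term of a minimizing sequence can be moved within its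
  orbit so as to almost realize the orbit distance to the base point; the sequence becomes bounded
  and compactness yields a minimizer.

  Conversely, let \<open>w\<close> be a minimizer. Suppose that \<open>F\<close> grows sublinearly along points \<open>u\<^sub>n\<close>, chosen
  within their orbits such that \<open>d(w, u\<^sub>n) = d\<^sub>G(Gw, Gu\<^sub>n) \<ge> 1\<close>. By convexity the points \<open>v\<^sub>n\<close> at
  distance \<open>1\<close> from \<open>w\<close> on the geodesics from \<open>w\<close> to \<open>u\<^sub>n\<close> form a minimizing sequence, which
  subconverges to a minimizer \<open>v\<close>. By transitivity \<open>v\<close> lies in the orbit of \<open>w\<close>, so
  \<open>d(w, u\<^sub>n) \<le> d(v, u\<^sub>n) \<le> d(v, v\<^sub>n) + d(w, u\<^sub>n) - 1\<close>, contradicting \<open>d(v, v\<^sub>n) \<rightarrow> 0\<close>.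
\<close>

section \<open>The lower semicontinuous extension and its infimum\<close>

lemma lsc_ext_le:
  assumes "u \<in> R"
  shows "lsc_ext R F u \<le> ereal (F u)"
  unfolding lsc_ext_def
proof (rule SUP_least)
  fix e :: real assume "e \<in> {0<..}"
  then show "(INF v\<in>{v\<in>R. dist u v \<le> e}. ereal (F v)) \<le> ereal (F u)"
    using assms by (intro INF_lower) auto
qed

lemma INF_le_lsc_ext: "(INF v\<in>R. ereal (F v)) \<le> lsc_ext R F u"
proof -
  have "(INF v\<in>R. ereal (F v)) \<le> (INF v\<in>{v\<in>R. dist u v \<le> 1}. ereal (F v))"
    by (rule INF_superset_mono) auto
  also have "\<dots> \<le> lsc_ext R F u"
    unfolding lsc_ext_def by (rule SUP_upper) simp
  finally show ?thesis .
qed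

text \<open>Lets minimality over the completion be tested on \<open>R\<close> alone: the extension
  lies below \<open>F\<close> on \<open>R\<close>, and every ball of radius 1 already bounds it
  below by the infimum over \<open>R\<close>.\<close>

lemma INF_lsc_ext: "(INF u. lsc_ext R F u) = (INF v\<in>R. ereal (F v))"
proof (rule antisym)
  show "(INF u. lsc_ext R F u) \<le> (INF v\<in>R. ereal (F v))"
    by (meson INF_greatest INF_lower2 UNIV_I lsc_ext_le)
  show "(INF v\<in>R. ereal (F v)) \<le> (INF u. lsc_ext R F u)"
    by (rule INF_greatest) (rule INF_le_lsc_ext)
qed

text \<open>Lower semicontinuity makes each real \<open>c < F u\<close> a lower bound for
  \<open>F\<close> on some ball about \<open>u\<close>, and that ball enters the supremum.\<close>

lemma lsc_ext_eq:
  assumes "lsc_on R F" and u: "u \<in> R"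
  shows "lsc_ext R F u = ereal (F u)"
proof (rule antisym[OF lsc_ext_le[OF u]])
  show "ereal (F u) \<le> lsc_ext R F u"
  proof (rule dense_le)
    fix y assume y: "y < ereal (F u)"
    show "y \<le> lsc_ext R F u"
    proof (cases y)
      case (real c)
      then have "\<forall>\<^sub>F v in at u within R. c < F v"
        using assms y unfolding lsc_on_def by auto
      then obtain e where e: "e > 0" "\<And>v. v \<in> R \<Longrightarrow> v \<noteq> u \<Longrightarrow> dist v u < e \<Longrightarrow> c < F v"
        unfolding eventually_at by auto
      \<comment> \<open>Halving \<open>e\<close> passes from the open ball of the filter to a closed
        ball. The filter omits the centre, where \<open>y < ereal (F u)\<close> serves
        instead.\<close>
      have "y \<le> (INF v\<in>{v\<in>R. dist u v \<le> e / 2}. ereal (F v))"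
      proof (rule INF_greatest)
        fix v assume "v \<in> {v\<in>R. dist u v \<le> e / 2}"
        then show "y \<le> ereal (F v)"
          using e(1) e(2)[of v] real y by (cases "v = u") (auto simp: dist_commute)
      qed
      also have "\<dots> \<le> lsc_ext R F u"
        unfolding lsc_ext_def by (rule SUP_upper) (use e in auto)
      finally show ?thesis .
    qed (use y in auto)
  qed
qed

lemma minimizer_le:
  assumes "lsc_on R F" "w \<in> minimizers R F" "w \<in> R" "u \<in> R"
  shows "F w \<le> F u"
proof -
  have "ereal (F w) = (INF v\<in>R. ereal (F v))"
    using assms lsc_ext_eq[of R F w] by (simp add: minimizers_def INF_lsc_ext)
  also have "\<dots> \<le> ereal (F u)"
    using assms by (intro INF_lower)
  finally show ?thesis by simp
qed

section \<open>Isometric actions and the orbit pseudometric\<close>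

locale isometric_action = group_action G R \<phi>
  for G :: "('g, 'm) monoid_scheme" (structure) and R :: "'a::metric_space set" and \<phi> +
  assumes isometry: "\<lbrakk>g \<in> carrier G; u \<in> R; v \<in> R\<rbrakk> \<Longrightarrow> dist (\<phi> g u) (\<phi> g v) = dist u v"
begin

sublocale group G
  using group_hom group_hom.axioms(1) by blast

lemma act_one: "u \<in> R \<Longrightarrow> \<phi> \<one> u = u"
  using id_eq_one by (metis restrict_apply')

lemma act_closed: "g \<in> carrier G \<Longrightarrow> u \<in> R \<Longrightarrow> \<phi> g u \<in> R"
  using element_image by blast

lemma orbit_dist_le:
  assumes "f \<in> carrier G" "g \<in> carrier G"
  shows "orbit_dist G \<phi> u v \<le> dist (\<phi> f u) (\<phi> g v)"
proof -
  have "bdd_below ((\<lambda>(f, g). dist (\<phi> f u) (\<phi> g v)) ` (carrier G \<times> carrier G))"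
    by (rule bdd_belowI[of _ 0]) auto
  from cINF_lower[OF this, of "(f, g)"] show ?thesis
    using assms unfolding orbit_dist_def by simp
qed

lemma orbit_dist_nonneg: "0 \<le> orbit_dist G \<phi> u v"
  unfolding orbit_dist_def by (rule cINF_greatest) auto

text \<open>Applying the isometry \<open>inv f\<close> to an almost optimal pair
  \<open>\<phi> f u\<close>, \<open>\<phi> g v\<close> brings the first point back to
  \<open>u\<close>, so only the second representative has to move.\<close>

lemma orbit_dist_approx:
  assumes "u \<in> R" "v \<in> R" "e > 0"
  obtains g where "g \<in> carrier G" "dist u (\<phi> g v) < orbit_dist G \<phi> u v + e"
proof -
  have "\<exists>p\<in>carrier G \<times> carrier G. (case p of (f, g) \<Rightarrow> dist (\<phi> f u) (\<phi> g v)) < orbit_dist G \<phi> u v + e"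
  proof (rule ccontr)
    assume "\<not> ?thesis"
    then have "orbit_dist G \<phi> u v + e \<le> orbit_dist G \<phi> u v"
      unfolding orbit_dist_def by (intro cINF_greatest) (auto simp: not_less)
    with \<open>e > 0\<close> show False by simp
  qed
  then obtain f g where fg: "f \<in> carrier G" "g \<in> carrier G"
      and less: "dist (\<phi> f u) (\<phi> g v) < orbit_dist G \<phi> u v + e" by auto
  have "dist u (\<phi> (inv f \<otimes> g) v) = dist (\<phi> (inv f) (\<phi> f u)) (\<phi> (inv f) (\<phi> g v))"
    using fg assms by (simp add: composition_rule orbit_sym_aux[OF fg(1) assms(1) refl])
  also have "\<dots> = dist (\<phi> f u) (\<phi> g v)"
    using fg assms by (simp add: isometry act_closed)
  finally show thesis
    using that[of "inv f \<otimes> g"] less fg by simp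
qed

text \<open>Serves to change the base point from a minimizer to \<open>z\<close>: a representative
  of \<open>v\<close> almost nearest to \<open>w\<close> is also a competitor for
  \<open>u\<close>.\<close>

lemma orbit_dist_triangle:
  assumes "u \<in> R" "v \<in> R" "w \<in> R"
  shows "orbit_dist G \<phi> u v \<le> dist u w + orbit_dist G \<phi> w v"
proof (rule field_le_epsilon)
  fix e :: real assume "e > 0"
  then obtain g where g: "g \<in> carrier G" "dist w (\<phi> g v) < orbit_dist G \<phi> w v + e"
    using orbit_dist_approx assms by blast
  have "orbit_dist G \<phi> u v \<le> dist u (\<phi> g v)"
    using orbit_dist_le[of \<one> g u v] g assms by (simp add: act_one)
  also have "\<dots> \<le> dist u w + dist w (\<phi> g v)" by (rule dist_triangle)
  finally show "orbit_dist G \<phi> u v \<le> dist u w + orbit_dist G \<phi> w v + e"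
    using g by simp
qed

section \<open>The two implications of the equivalence\<close>

lemma coercive_imp_minimizer:
  fixes F :: "'a \<Rightarrow> real"
  assumes z: "z \<in> R"
    and compact: "\<And>(u :: nat \<Rightarrow> 'a) C. (\<lambda>j. lsc_ext R F (u j)) \<longlonglongrightarrow> (INF v. lsc_ext R F v) \<Longrightarrow>
          C > 0 \<Longrightarrow> (\<And>j. dist z (u j) \<le> C) \<Longrightarrow> minimizers R F \<noteq> {}"
    and inv: "\<And>g u. g \<in> carrier G \<Longrightarrow> u \<in> R \<Longrightarrow> F (\<phi> g u) = F u"
    and C: "C > 0" and coercive: "\<And>u. u \<in> R \<Longrightarrow> F u \<ge> C * orbit_dist G \<phi> z u - D"
  shows "minimizers R F \<noteq> {}"
proof -
  define m where "m = (INF v\<in>R. F v)"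
  have "F u \<ge> - D" if "u \<in> R" for u
    using coercive[OF that] mult_nonneg_nonneg[OF less_imp_le[OF C] orbit_dist_nonneg[of z u]] by linarith
  then have bdd: "bdd_below (F ` R)"
    by (intro bdd_belowI[of _ "- D"]) auto
  have m_le: "m \<le> F u" if "u \<in> R" for u
    unfolding m_def using bdd that by (rule cINF_lower)
  \<comment> \<open>Coercivity and \<open>F u < m + 1\<close> bound the orbit distance by
    \<open>(m + 1 + D) / C\<close>; the extra 1 pays for an almost optimal representative.
    Invariance keeps the value of \<open>F\<close> under this move.\<close>
  have "\<exists>u\<in>R. F u < m + 1 / Suc n \<and> dist z u \<le> (m + 1 + D) / C + 1" for n
  proof -
    have "\<exists>u\<in>R. F u < m + 1 / Suc n"
      using cINF_less_iff[OF _ bdd, of "m + 1 / Suc n"] z unfolding m_def by auto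
    then obtain u where u: "u \<in> R" "F u < m + 1 / Suc n" by blast
    obtain g where g: "g \<in> carrier G" "dist z (\<phi> g u) < orbit_dist G \<phi> z u + 1"
      using orbit_dist_approx[OF z u(1), of 1] by auto
    have "1 / real (Suc n) \<le> 1" by simp
    then have "C * orbit_dist G \<phi> z u \<le> m + 1 + D"
      using coercive[OF u(1)] u(2) by linarith
    then have "orbit_dist G \<phi> z u \<le> (m + 1 + D) / C"
      using C by (simp add: field_simps)
    then show ?thesis
      using g u inv act_closed by (intro bexI[of _ "\<phi> g u"]) auto
  qed
  then obtain u where u: "\<And>n. u n \<in> R" "\<And>n. F (u n) < m + 1 / Suc n"
      "\<And>n. dist z (u n) \<le> (m + 1 + D) / C + 1"
    by metis
  have lim: "(\<lambda>n. ereal (m + 1 / Suc n)) \<longlonglongrightarrow> ereal m"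
    using tendsto_add[OF tendsto_const LIMSEQ_inverse_real_of_nat, of m] by (simp add: inverse_eq_divide)
  have m_eq: "(INF v. lsc_ext R F v) = ereal m"
  proof (rule antisym)
    show "(INF v. lsc_ext R F v) \<le> ereal m"
    proof (rule LIMSEQ_le_const[OF lim])
      have "(INF v. lsc_ext R F v) \<le> ereal (m + 1 / Suc n)" for n
        by (rule INF_lower2[of "u n"]) (use lsc_ext_le[of "u n" R F] u[of n] in \<open>auto intro: order_trans\<close>)
      then show "\<exists>N. \<forall>n\<ge>N. (INF v. lsc_ext R F v) \<le> ereal (m + 1 / Suc n)" by blast
    qed
    show "ereal m \<le> (INF v. lsc_ext R F v)"
      unfolding INF_lsc_ext by (rule INF_greatest) (simp add: m_le)
  qed
  have "(\<lambda>n. lsc_ext R F (u n)) \<longlonglongrightarrow> ereal m"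
  proof (rule tendsto_sandwich[OF always_eventually always_eventually tendsto_const lim]; intro allI)
    fix n
    show "ereal m \<le> lsc_ext R F (u n)"
      unfolding m_eq[symmetric] by (rule INF_lower) simp
    show "lsc_ext R F (u n) \<le> ereal (m + 1 / Suc n)"
      using lsc_ext_le[OF u(1)[of n], of F] u(2)[of n] by (auto intro: order_trans)
  qed
  moreover have "dist z (u n) \<le> \<bar>(m + 1 + D) / C + 1\<bar> + 1" for n
    using u(3)[of n] by linarith
  ultimately show ?thesis
    using compact[of u "\<bar>(m + 1 + D) / C + 1\<bar> + 1"] m_eq by (simp add: add_nonneg_pos)
qed

text \<open>The threshold 1 guarantees that a geodesic from \<open>w\<close> to a nearest
  representative reaches distance 1 from \<open>w\<close>, so compactness is needed only in the unit
  ball about \<open>w\<close>.\<close>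

lemma minimizer_imp_linear_growth:
  fixes F :: "'a \<Rightarrow> real"
  assumes lsc: "lsc_on R F" and w: "w \<in> minimizers R F" "w \<in> R"
    and geodesic: "\<And>u. u \<in> R \<Longrightarrow>
          \<exists>c. geodesic_segment w u c \<and> ereal_convex_on {0..1} (\<lambda>t. lsc_ext R F (c t))"
    and compact: "\<And>v :: nat \<Rightarrow> 'a. (\<lambda>j. lsc_ext R F (v j)) \<longlonglongrightarrow> (INF v. lsc_ext R F v) \<Longrightarrow>
          (\<And>j. dist w (v j) \<le> 1) \<Longrightarrow>
          \<exists>v'\<in>minimizers R F. \<exists>r. strict_mono r \<and> (v \<circ> r) \<longlonglongrightarrow> v'"
    and transitive: "\<And>v. v \<in> minimizers R F \<Longrightarrow> \<exists>g\<in>carrier G. \<phi> g w = v"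
    and attained: "\<And>u. u \<in> R \<Longrightarrow> \<exists>g\<in>carrier G. orbit_dist G \<phi> w u = dist w (\<phi> g u)"
    and inv: "\<And>g u. g \<in> carrier G \<Longrightarrow> u \<in> R \<Longrightarrow> F (\<phi> g u) = F u"
  obtains C where "C > 0"
    and "\<And>u. u \<in> R \<Longrightarrow> orbit_dist G \<phi> w u \<ge> 1 \<Longrightarrow> F u - F w \<ge> C * orbit_dist G \<phi> w u"
proof (rule ccontr)
  assume no_thesis: "\<not> thesis"
  note witness = that
  have no_C: "\<not> (\<forall>u\<in>R. orbit_dist G \<phi> w u \<ge> 1 \<longrightarrow> F u - F w \<ge> C * orbit_dist G \<phi> w u)"
    if C: "C > 0" for C
    using witness[OF C] no_thesis by blast
  have inf: "(INF v. lsc_ext R F v) = ereal (F w)"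
    using w lsc_ext_eq[OF lsc w(2)] by (simp add: minimizers_def)
  \<comment> \<open>Failure of the bound for \<open>C = 1 / Suc n\<close> gives \<open>u\<close>,
    and \<open>v\<close> lies on the geodesic towards it. The last clause covers all
    \<open>h\<close> because the orbit point to which the \<open>v\<close> subconverge is known only
    later.\<close>
  have "\<exists>u v. lsc_ext R F v \<le> ereal (F w + 1 / Suc n) \<and> dist w v = 1 \<and>
          (\<forall>h\<in>carrier G. dist v u + 1 \<le> dist (\<phi> h w) u)" for n
  proof -
    obtain u0 where u0: "u0 \<in> R" "orbit_dist G \<phi> w u0 \<ge> 1"
        "F u0 - F w < 1 / Suc n * orbit_dist G \<phi> w u0"
      using no_C[of "1 / Suc n"] by (auto simp: not_le)
    obtain g where g: "g \<in> carrier G" "orbit_dist G \<phi> w u0 = dist w (\<phi> g u0)"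
      using attained u0 by blast
    \<comment> \<open>With this representative, \<open>w\<close> is a nearest point to
      \<open>u\<close> in its own orbit.\<close>
    define u where "u = \<phi> g u0"
    define d where "d = dist w u"
    have u: "u \<in> R" "F u = F u0" and d: "d = orbit_dist G \<phi> w u0" "d \<ge> 1"
      using u0 g by (auto simp: u_def d_def act_closed inv)
    obtain c where c: "geodesic_segment w u c" "ereal_convex_on {0..1} (\<lambda>t. lsc_ext R F (c t))"
      using geodesic u by blast
    have ends: "c 0 = w" "c 1 = u"
      and dc: "\<And>a b. a \<in> {0..1} \<Longrightarrow> b \<in> {0..1} \<Longrightarrow> dist (c a) (c b) = \<bar>a - b\<bar> * d"
      using c(1) by (auto simp: geodesic_segment_def d_def)
    have t: "1 / d \<in> {0..1}" using d by auto
    \<comment> \<open>Parameter \<open>1/d\<close> is the point at distance 1 from \<open>w\<close>.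
      The slope \<open>(F u0 - F w) / d\<close> is then the only excess over \<open>F w\<close>, and
      it is below \<open>1 / Suc n\<close>.\<close>
    have "lsc_ext R F (c ((1 - 1/d) *\<^sub>R 0 + (1/d) *\<^sub>R 1))
        \<le> ereal (1 - 1/d) * lsc_ext R F (c 0) + ereal (1/d) * lsc_ext R F (c 1)"
      using c(2) t unfolding ereal_convex_on_def by (metis atLeastAtMost_iff order_refl zero_le_one)
    then have "lsc_ext R F (c (1/d)) \<le> ereal ((1 - 1/d) * F w + 1/d * F u)"
      using lsc_ext_eq[OF lsc] u w by (simp add: ends)
    also have "(1 - 1/d) * F w + 1/d * F u = F w + (F u0 - F w) / d"
      using u by (simp add: algebra_simps diff_divide_distrib)
    also have "ereal \<dots> \<le> ereal (F w + 1 / Suc n)"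
    proof -
      have "(F u0 - F w) / d \<le> 1 / Suc n"
        using u0(3) d by (simp add: pos_divide_le_eq)
      then show ?thesis by simp
    qed
    finally have "lsc_ext R F (c (1/d)) \<le> ereal (F w + 1 / Suc n)" .
    moreover have "dist w (c (1/d)) = 1"
      using dc[of 0 "1/d"] t d by (simp add: ends)
    moreover have "dist (c (1/d)) u + 1 = d"
      using dc[of "1/d" 1] t d by (simp add: ends abs_if field_simps)
    moreover have "d \<le> dist (\<phi> h w) u" if "h \<in> carrier G" for h
      using orbit_dist_le[OF that g(1)] by (simp add: d u_def)
    ultimately show ?thesis
      by (intro exI[of _ u] exI[of _ "c (1/d)"]) simp
  qed
  then obtain u v where v: "\<And>n. lsc_ext R F (v n) \<le> ereal (F w + 1 / Suc n)" "\<And>n. dist w (v n) = 1"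
      "\<And>n h. h \<in> carrier G \<Longrightarrow> dist (v n) (u n) + 1 \<le> dist (\<phi> h w) (u n)"
    by metis
  have lim: "(\<lambda>n. ereal (F w + 1 / Suc n)) \<longlonglongrightarrow> ereal (F w)"
    using tendsto_add[OF tendsto_const LIMSEQ_inverse_real_of_nat, of "F w"]
    by (simp add: inverse_eq_divide)
  have "(\<lambda>n. lsc_ext R F (v n)) \<longlonglongrightarrow> ereal (F w)"
  proof (rule tendsto_sandwich[OF always_eventually always_eventually tendsto_const lim]; intro allI)
    show "ereal (F w) \<le> lsc_ext R F (v n)" for n
      unfolding inf[symmetric] by (rule INF_lower) simp
  qed (rule v)
  then obtain v' r where v': "v' \<in> minimizers R F" "(v \<circ> r) \<longlonglongrightarrow> v'"
    using compact[of v] inf v(2) by auto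
  obtain h where h: "h \<in> carrier G" "\<phi> h w = v'"
    using transitive v' by blast
  \<comment> \<open>One index suffices: \<open>v (r n)\<close> is closer than 1 to
    \<open>v'\<close>, yet at least 1 closer than \<open>v'\<close> to
    \<open>u (r n)\<close>.\<close>
  obtain n where "dist (v (r n)) v' < 1"
    using metric_LIMSEQ_D[OF v'(2), of 1] by auto
  moreover have "dist (v (r n)) (u (r n)) + 1 \<le> dist v' (u (r n))"
    using v(3) h by blast
  ultimately show False
    using dist_triangle[of v' "u (r n)" "v (r n)"] by (simp add: dist_commute)
qed

end


theorem theorem3p4:
  fixes R :: "'a::complete_space set"
    and z :: 'a
    and F :: "'a \<Rightarrow> real"
    and G :: "('g, 'm) monoid_scheme"
    and \<phi> :: "'g \<Rightarrow> 'a \<Rightarrow> 'a"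
  assumes completion: "closure R = UNIV"
    and base_point: "z \<in> R"
    and lsc: "lsc_on R F"
    and ext_range: "\<And>u. lsc_ext R F u \<noteq> - \<infinity>"
    and action: "group_action G R \<phi>"
    and P1: "\<And>u0 u1. u0 \<in> R \<Longrightarrow> u1 \<in> R \<Longrightarrow>
          \<exists>u. geodesic_segment u0 u1 u \<and>
              continuous_on {0..1} (\<lambda>t. lsc_ext R F (u t)) \<and>
              ereal_convex_on {0..1} (\<lambda>t. lsc_ext R F (u t))"
    and P2: "\<And>(u :: nat \<Rightarrow> 'a) C.
          (\<lambda>j. lsc_ext R F (u j)) \<longlonglongrightarrow> (INF v. lsc_ext R F v) \<Longrightarrow>
          C > 0 \<Longrightarrow> (\<And>j. dist z (u j) \<le> C) \<Longrightarrow>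
          \<exists>w\<in>minimizers R F. \<exists>r. strict_mono r \<and> (u \<circ> r) \<longlonglongrightarrow> w"
    and P3: "minimizers R F \<subseteq> R"
    and P4: "\<And>g u v. g \<in> carrier G \<Longrightarrow> u \<in> R \<Longrightarrow> v \<in> R \<Longrightarrow>
          dist (\<phi> g u) (\<phi> g v) = dist u v"
    and P5: "transitive_action G (minimizers R F) (\<lambda>g. restrict (\<phi> g) (minimizers R F))"
    and P6: "minimizers R F \<noteq> {} \<Longrightarrow>
          (\<And>u v. u \<in> R \<Longrightarrow> v \<in> R \<Longrightarrow> \<exists>g\<in>carrier G. orbit_dist G \<phi> u v = dist u (\<phi> g v))"
    and P7: "\<And>u v g. u \<in> R \<Longrightarrow> v \<in> R \<Longrightarrow> g \<in> carrier G \<Longrightarrow>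
          increment F u v = increment F (\<phi> g u) (\<phi> g v)"
  shows "minimizers R F \<noteq> {} \<longleftrightarrow>
         (\<forall>g\<in>carrier G. \<forall>u\<in>R. F (\<phi> g u) = F u) \<and>
         (\<exists>C>0. \<exists>D>0. \<forall>u\<in>R. F u \<ge> C * orbit_dist G \<phi> z u - D)"
proof -
  interpret isometric_action G R \<phi>
    using action P4 by (simp add: isometric_action_def isometric_action_axioms_def)
  let ?M = "minimizers R F"
  show ?thesis
  proof (intro iffI conjI; (elim conjE exE)?)
    assume "?M \<noteq> {}"
    then obtain w where w: "w \<in> ?M" "w \<in> R" using P3 by blast
    have transitive: "\<exists>g\<in>carrier G. \<phi> g w = v" if "v \<in> ?M" for v
      using transitive_action.unique_orbit[OF P5 w(1) that] w by simp
    show inv: "\<forall>g\<in>carrier G. \<forall>u\<in>R. F (\<phi> g u) = F u"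
    proof (intro ballI)
      fix g u assume g: "g \<in> carrier G" and u: "u \<in> R"
      \<comment> \<open>Since \<open>\<phi> g w\<close> is again a minimizer, \<open>F\<close>
        agrees at \<open>w\<close> and \<open>\<phi> g w\<close>; preservation of increments carries
        this equality to every \<open>u\<close>.\<close>
      have "\<phi> g w \<in> ?M"
        using group_action.element_image[OF transitive_action.axioms(1)[OF P5] g w(1) refl] w by simp
      then have "F (\<phi> g w) = F w"
        using minimizer_le[OF lsc] w P3 by (meson antisym subsetD)
      then show "F (\<phi> g u) = F u"
        using P7[OF u w(2) g] by (simp add: increment_def)
    qed
    obtain C where C: "C > 0"
      "\<And>u. u \<in> R \<Longrightarrow> orbit_dist G \<phi> w u \<ge> 1 \<Longrightarrow> F u - F w \<ge> C * orbit_dist G \<phi> w u"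
    proof (rule minimizer_imp_linear_growth[OF lsc w])
      show "\<exists>c. geodesic_segment w u c \<and> ereal_convex_on {0..1} (\<lambda>t. lsc_ext R F (c t))"
        if "u \<in> R" for u
        using P1[OF w(2) that] by blast
      show "\<exists>v'\<in>?M. \<exists>r. strict_mono r \<and> (v \<circ> r) \<longlonglongrightarrow> v'"
        if lim: "(\<lambda>j. lsc_ext R F (v j)) \<longlonglongrightarrow> (INF v. lsc_ext R F v)"
          and bound: "\<And>j. dist w (v j) \<le> 1" for v :: "nat \<Rightarrow> 'a"
      proof (rule P2[OF lim])
        show "dist z w + 1 > 0" by (simp add: add_nonneg_pos)
        show "dist z (v j) \<le> dist z w + 1" for j
          using dist_triangle[of z "v j" w] bound[of j] by simp
      qed
    qed (use transitive inv P6 \<open>?M \<noteq> {}\<close> w in auto)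
    \<comment> \<open>The bracket collects the cost of moving the base point from \<open>w\<close>
      to \<open>z\<close>, the loss \<open>C\<close> inside orbit distance 1, and
      \<open>F w\<close>; the absolute value and the 1 force positivity.\<close>
    let ?D = "\<bar>C * dist z w + C - F w\<bar> + 1"
    have "F u \<ge> C * orbit_dist G \<phi> z u - ?D" if u: "u \<in> R" for u
    proof -
      \<comment> \<open>Subtracting \<open>C\<close> makes the right side negative when the orbit
        distance is below 1, where minimality of \<open>w\<close> is enough.\<close>
      have "F u - F w \<ge> C * orbit_dist G \<phi> w u - C"
      proof (cases "orbit_dist G \<phi> w u \<ge> 1")
        case True
        then show ?thesis using C(1) C(2)[OF u] by simp
      next
        case False
        then have "C * orbit_dist G \<phi> w u \<le> C * 1"
          using C(1) by (intro mult_left_mono) auto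
        then show ?thesis using minimizer_le[OF lsc w u] by simp
      qed
      moreover have "C * orbit_dist G \<phi> z u \<le> C * dist z w + C * orbit_dist G \<phi> w u"
        using mult_left_mono[OF orbit_dist_triangle[OF base_point u w(2)], of C] C(1)
        by (simp add: distrib_left)
      ultimately show ?thesis by linarith
    qed
    moreover have "?D > 0" by linarith
    ultimately show "\<exists>C>0. \<exists>D>0. \<forall>u\<in>R. F u \<ge> C * orbit_dist G \<phi> z u - D"
      using C(1) by blast
  next
    fix C D :: real
    assume "\<forall>g\<in>carrier G. \<forall>u\<in>R. F (\<phi> g u) = F u"
      and "C > 0" "\<forall>u\<in>R. F u \<ge> C * orbit_dist G \<phi> z u - D"
    then show "?M \<noteq> {}"
      using coercive_imp_minimizer[OF base_point, of F C D] P2 by blast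
  qed
qed

end
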